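(* Let $n, s_1, s_2$ be integers such that $0\le s_1<s_2<n$, and let $a,b$ be non-zero complex numbers. Put $s=s_2-s_1$, $d=(n,s)=\gcd(n,s)$ and $m=n\backslash s=n/\gcd(n,s)$. Then $$aP_n^{s_1}+bP_n^{s_2}=P_n^{s_1}\,P_{\sigma_{n,s}}\left[I_{d}\otimes\left(aI_{m}+bP_{m}\right)\right]P_{\sigma_{n,s}}^{T}.$$
   Context: Indices of $n\times n$ matrices run over $[n]:=\{0,1,\dots,n-1\}$, and permutations are bijections of $[n]$. For a permutation $\alpha$ of $[n]$, $P_\alpha$ is the $n\times n$ matrix with $(P_\alpha)_{\alpha(j),j}=1$ for each $j$ and all other entries $0$. $P_n:=P_{\tau_n}$ where $\tau_n(i)=(i-1)\bmod n$; thus $(P_n)_{i,j}=1$ if $j\equiv i+1 \pmod n$ and $0$ otherwise. $I_n$ is the identity, $\otimes$ is the Kronecker product. For integers $0<s<n$, $(n,s)$ is the greatest common divisor and $n\backslash s:=n/(n,s)$. The permutation $\sigma_{n,s}$ of $[n]$ is $\sigma_{n,s}:=\widehat F_{n,s}\circ J_{n,s}$, where $J_{n,s}:[n]\to[(n,s)]\times[n\backslash s]$ is $J_{n,s}(i)=(\varrho_{n,s}(i),\ell_{n,s}(i))$ with $\varrho_{n,s}(i)=\max\{k\in[(n,s)]: i\ge k\,(n\backslash s)\}$ and $\ell_{n,s}(i)=(i-\varrho_{n,s}(i)\,(n\backslash s))\bmod (n\backslash s)$, and $\widehat F_{n,s}:[(n,s)]\times[n\backslash s]\to[n]$ is $\widehat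 F_{n,s}(x,y)=(sy+x)\bmod n$. *)

theory Defs
  imports "Jordan_Normal_Form.Matrix" "HOL-Number_Theory.Cong" Complex_Main
begin

text \<open>
  Matrix indices run over \<open>{0..<n}\<close>, as in the matrix library. A permutation of
  \<open>{0..<n}\<close> is represented by a function on the natural numbers of which only the values
  below \<open>n\<close> matter.
\<close>

definition perm_mat :: "nat \<Rightarrow> (nat \<Rightarrow> nat) \<Rightarrow> complex mat" where
  "perm_mat n \<alpha> = mat n n (\<lambda>(i, j). if i = \<alpha> j then 1 else 0)"

(* The subtraction is carried out on the integers, so that 0 is sent to n - 1. *)
definition tau :: "nat \<Rightarrow> nat \<Rightarrow> nat" where
  "tau n i = nat ((int i - 1) mod int n)"

definition shift_mat :: "nat \<Rightarrow> complex mat" where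
  "shift_mat n = perm_mat n (tau n)"

definition kronecker :: "'a :: times mat \<Rightarrow> 'a mat \<Rightarrow> 'a mat" (infixl "\<otimes>\<^sub>K" 70) where
  "A \<otimes>\<^sub>K B = mat (dim_row A * dim_row B) (dim_col A * dim_col B)
     (\<lambda>(i, j). A $$ (i div dim_row B, j div dim_col B) * B $$ (i mod dim_row B, j mod dim_col B))"

(* This is the number written n \<setminus> s in the literature. *)
definition gcd_quot :: "nat \<Rightarrow> nat \<Rightarrow> nat" where
  "gcd_quot n s = n div gcd n s"

definition rho :: "nat \<Rightarrow> nat \<Rightarrow> nat \<Rightarrow> nat" where
  "rho n s i = Max {k. k < gcd n s \<and> i \<ge> k * gcd_quot n s}"

(* The natural-number subtraction does not truncate: rho n s i * gcd_quot n s \<le> i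
   by the choice of rho, provided that gcd n s > 0. *)
definition ell :: "nat \<Rightarrow> nat \<Rightarrow> nat \<Rightarrow> nat" where
  "ell n s i = (i - rho n s i * gcd_quot n s) mod gcd_quot n s"

definition J_map :: "nat \<Rightarrow> nat \<Rightarrow> nat \<Rightarrow> nat \<times> nat" where
  "J_map n s i = (rho n s i, ell n s i)"

definition F_map :: "nat \<Rightarrow> nat \<Rightarrow> nat \<times> nat \<Rightarrow> nat" where
  "F_map n s = (\<lambda>(x, y). (s * y + x) mod n)"

definition sigma :: "nat \<Rightarrow> nat \<Rightarrow> nat \<Rightarrow> nat" where
  "sigma n s = F_map n s \<circ> J_map n s"

lemma bij_betw_tau:
  assumes "0 < n"
  shows "bij_betw (tau n) {0..<n} {0..<n}"
proof -
  have eq: "tau n i = (if i = 0 then n - 1 else i - 1)" if "i < n" for i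
  proof (cases "i = 0")
    case True
    then show ?thesis using assms by (simp add: tau_def zmod_minus1 nat_diff_distrib')
  next
    case False
    then have "(int i - 1) mod int n = int i - 1" using that by (intro mod_pos_pos_trivial) auto
    then show ?thesis using False by (simp add: tau_def)
  qed
  show ?thesis
    by (rule bij_betw_byWitness[where f' = "\<lambda>i. if i = n - 1 then 0 else i + 1"])
      (auto simp: eq)
qed

lemma rho_eq:
  assumes "0 < s" "s < n" "i < n"
  shows "rho n s i = i div gcd_quot n s"
proof -
  let ?d = "gcd n s" and ?m = "gcd_quot n s"
  have n: "n = ?d * ?m" by (simp add: gcd_quot_def)
  have m: "0 < ?m" using n assms by (cases "?m = 0") auto
  have q: "i div ?m < ?d" using n assms by (metis less_mult_imp_div_less)
  have "{k. k < ?d \<and> i \<ge> k * ?m} = {..i div ?m}"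
    using q less_eq_div_iff_mult_less_eq[OF m, of _ i] by (auto intro: le_less_trans)
  moreover have "Max {..i div ?m} = i div ?m" by (rule Max_eqI) auto
  ultimately show ?thesis by (simp add: rho_def)
qed

lemma ell_eq:
  assumes "0 < s" "s < n" "i < n"
  shows "ell n s i = i mod gcd_quot n s"
  using rho_eq[OF assms] by (simp add: ell_def minus_div_mult_eq_mod)

lemma bij_betw_sigma:
  assumes "0 < s" "s < n"
  shows "bij_betw (sigma n s) {0..<n} {0..<n}"
proof -
  let ?d = "gcd n s" and ?m = "gcd_quot n s"
  have n: "n = ?d * ?m" by (simp add: gcd_quot_def)
  have m: "0 < ?m" using n assms by (cases "?m = 0") auto
  have sig: "sigma n s i = (s * (i mod ?m) + i div ?m) mod n" if "i < n" for i
    using rho_eq[OF assms that] ell_eq[OF assms that] by (simp add: sigma_def F_map_def J_map_def)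
  have "inj_on (sigma n s) {0..<n}"
  proof (rule inj_onI)
    fix i j assume ij: "i \<in> {0..<n}" "j \<in> {0..<n}" and e: "sigma n s i = sigma n s j"
    have c: "[s * (i mod ?m) + i div ?m = s * (j mod ?m) + j div ?m] (mod n)"
      using e ij sig by (simp add: cong_def)
    have "[s * (i mod ?m) + i div ?m = s * (j mod ?m) + j div ?m] (mod ?d)"
      by (rule cong_dvd_modulus_nat[OF c]) simp
    moreover have "[s * k + l = l] (mod ?d)" for k l
      using cong_add_rcancel_0_nat cong_mult_self_left
      by (metis cong_0_iff dvd_mult2 gcd_dvd2)
    ultimately have "[i div ?m = j div ?m] (mod ?d)" by (meson cong_sym cong_trans)
    moreover have "i div ?m < ?d" "j div ?m < ?d"
      using n ij by (metis atLeastLessThan_iff less_mult_imp_div_less)+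
    ultimately have x: "i div ?m = j div ?m" using cong_less_modulus_unique_nat by blast
    then have "[s * (i mod ?m) = s * (j mod ?m)] (mod n)" using c by (simp add: cong_add_rcancel_nat)
    then have "[?d * ((s div ?d) * (i mod ?m)) = ?d * ((s div ?d) * (j mod ?m))] (mod ?d * ?m)"
      using n by (metis dvd_mult_div_cancel gcd_dvd2 mult.assoc)
    then have "[(s div ?d) * (i mod ?m) = (s div ?d) * (j mod ?m)] (mod ?m)"
      using assms by (simp add: cong_def mult_mod_right[symmetric])
    moreover have "coprime (s div ?d) ?m" unfolding gcd_quot_def
      using assms by (metis coprime_commute div_gcd_coprime less_numeral_extra(3))
    ultimately have "[i mod ?m = j mod ?m] (mod ?m)" by (simp add: cong_mult_lcancel_nat)
    then have "i mod ?m = j mod ?m" by (simp add: cong_def)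
    with x show "i = j" by (metis div_mult_mod_eq)
  qed
  moreover have "sigma n s ` {0..<n} \<subseteq> {0..<n}" using assms by (auto simp: sig)
  ultimately show ?thesis by (simp add: bij_betw_def endo_inj_surj)
qed

end

theory Submission
  imports Defs
begin

text \<open>
  Conjugating by \<open>P\<^sub>\<sigma>\<close> moves the entry at \<open>(i, j)\<close> to \<open>(\<sigma> i, \<sigma> j)\<close>. Since \<open>\<sigma>\<close> sends
  \<open>x m + y\<close> to \<open>s y + x\<close> modulo \<open>n\<close>, a cyclic step \<open>y \<mapsto> y + 1\<close> inside a block of length \<open>m\<close>
  becomes a step by \<open>s\<close> modulo \<open>n\<close>, the wrap-around being harmless because \<open>n\<close> divides \<open>s m\<close>.
  So the block diagonal matrix is conjugate to \<open>a I + b P\<^sub>n\<^sup>s\<close>, and it remains to multiply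
  by \<open>P\<^sub>n\<close> to the power \<open>s\<^sub>1\<close>.
\<close>

lemma perm_mat_carrier [simp]: "perm_mat n \<alpha> \<in> carrier_mat n n"
  by (simp add: perm_mat_def)

text \<open>By injectivity, row \<open>\<alpha> i\<close> of the permutation matrix has its only 1
  in column \<open>i\<close>, so the sum for the product has one surviving term. Row indices of the
  form \<open>\<alpha> i\<close> avoid any mention of the inverse permutation.\<close>

lemma index_perm_mat_mult:
  assumes "inj_on \<alpha> {0..<n}" "\<alpha> i < n" "i < n" "j < nc" "A \<in> carrier_mat n nc"
  shows "(perm_mat n \<alpha> * A) $$ (\<alpha> i, j) = A $$ (i, j)"
proof -
  have "(perm_mat n \<alpha> * A) $$ (\<alpha> i, j) = (\<Sum>k\<in>{0..<n}. (if \<alpha> i = \<alpha> k then 1 else 0) * A $$ (k, j))"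
    using assms by (auto simp: perm_mat_def scalar_prod_def intro!: sum.cong)
  also have "\<dots> = (\<Sum>k\<in>{0..<n}. if k = i then A $$ (k, j) else 0)"
    using assms by (intro sum.cong) (auto dest: inj_onD)
  finally show ?thesis using assms by simp
qed

lemma index_mult_transpose_perm_mat:
  assumes "inj_on \<alpha> {0..<n}" "\<alpha> j < n" "j < n" "i < nr" "A \<in> carrier_mat nr n"
  shows "(A * transpose_mat (perm_mat n \<alpha>)) $$ (i, \<alpha> j) = A $$ (i, j)"
proof -
  have "(A * transpose_mat (perm_mat n \<alpha>)) $$ (i, \<alpha> j) =
      (\<Sum>k\<in>{0..<n}. A $$ (i, k) * (if \<alpha> j = \<alpha> k then 1 else 0))"
    using assms by (auto simp: perm_mat_def scalar_prod_def intro!: sum.cong)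
  also have "\<dots> = (\<Sum>k\<in>{0..<n}. if k = j then A $$ (i, k) else 0)"
    using assms by (intro sum.cong) (auto dest: inj_onD)
  finally show ?thesis using assms by simp
qed

text \<open>Surjectivity of \<alpha> writes every row and column index as an image, so comparing
  entries at images settles equality.\<close>

lemma conjugate_perm_mat_eqI:
  assumes bij: "bij_betw \<alpha> {0..<n} {0..<n}"
    and A: "A \<in> carrier_mat n n" and B: "B \<in> carrier_mat n n"
    and entries: "\<And>i j. i < n \<Longrightarrow> j < n \<Longrightarrow> B $$ (\<alpha> i, \<alpha> j) = A $$ (i, j)"
  shows "perm_mat n \<alpha> * A * transpose_mat (perm_mat n \<alpha>) = B"
proof (rule eq_matI)
  fix p q assume "p < dim_row B" "q < dim_col B"
  then have "p \<in> \<alpha> ` {0..<n}" "q \<in> \<alpha> ` {0..<n}"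
    using B bij by (simp_all add: bij_betw_def)
  then obtain i j where ij: "i < n" "j < n" and pq: "p = \<alpha> i" "q = \<alpha> j"
    by auto
  have "\<alpha> i < n" "\<alpha> j < n"
    using bij ij by (auto dest: bij_betwE)
  moreover have "inj_on \<alpha> {0..<n}"
    using bij by (simp add: bij_betw_def)
  moreover have "perm_mat n \<alpha> * A \<in> carrier_mat n n"
    using A by (intro mult_carrier_mat[of _ _ n]) simp_all
  ultimately have "(perm_mat n \<alpha> * A * transpose_mat (perm_mat n \<alpha>)) $$ (p, q) = A $$ (i, j)"
    \<comment> \<open>The deleted rules would expand the product into scalar products or reassociate
      it before the two index lemmas can apply.\<close>
    using A ij by (simp add: pq index_mult_transpose_perm_mat index_perm_mat_mult
        del: index_mult_mat(1) assoc_mult_mat)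
  then show "(perm_mat n \<alpha> * A * transpose_mat (perm_mat n \<alpha>)) $$ (p, q) = B $$ (p, q)"
    using entries ij pq by simp
qed (use B in \<open>simp_all add: perm_mat_def\<close>)

lemma shift_mat_carrier [simp]: "shift_mat n \<in> carrier_mat n n"
  by (simp add: shift_mat_def)

lemma dim_shift_mat [simp]: "dim_row (shift_mat n) = n" "dim_col (shift_mat n) = n"
  by (simp_all add: shift_mat_def perm_mat_def)

lemma dim_shift_mat_pow [simp]:
  "dim_row (shift_mat n ^\<^sub>m k) = n" "dim_col (shift_mat n ^\<^sub>m k) = n"
  using pow_carrier_mat[OF shift_mat_carrier, of n k] by auto

text \<open>Reading the matrix by rows replaces the backward step \<open>tau\<close> by a successor,
  free of integer subtraction.\<close>

lemma index_shift_mat: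
  assumes "i < n" "j < n"
  shows "shift_mat n $$ (i, j) = (if j = Suc i mod n then 1 else 0)"
proof -
  have "tau n j = (if j = 0 then n - 1 else j - 1)"
  proof (cases "j = 0")
    case True
    then show ?thesis using assms by (simp add: tau_def zmod_minus1 nat_diff_distrib')
  next
    case False
    then have "(int j - 1) mod int n = int j - 1"
      using assms by (intro mod_pos_pos_trivial) auto
    then show ?thesis using False by (simp add: tau_def)
  qed
  then have "i = tau n j \<longleftrightarrow> j = Suc i mod n"
    using assms by (auto simp: mod_Suc)
  then show ?thesis using assms by (simp add: shift_mat_def perm_mat_def)
qed

lemma index_shift_mat_pow:
  assumes "i < n" "j < n"
  shows "(shift_mat n ^\<^sub>m k) $$ (i, j) = (if j = (i + k) mod n then 1 else 0)"
  using assms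
\<comment> \<open>The column is generalised because the induction hypothesis is needed at every
  summation index \<open>l\<close>.\<close>
proof (induction k arbitrary: j)
  case 0
  then show ?case by (auto simp: shift_mat_def perm_mat_def)
next
  case (Suc k)
  have "(shift_mat n ^\<^sub>m Suc k) $$ (i, j) =
      (\<Sum>l\<in>{0..<n}. (shift_mat n ^\<^sub>m k) $$ (i, l) * shift_mat n $$ (l, j))"
    using Suc.prems by (simp add: scalar_prod_def)
  also have "\<dots> = (\<Sum>l\<in>{0..<n}. if l = (i + k) mod n then shift_mat n $$ (l, j) else 0)"
    using Suc by (intro sum.cong) auto
  also have "\<dots> = shift_mat n $$ ((i + k) mod n, j)"
    using Suc.prems by simp
  also have "\<dots> = (if j = (i + Suc k) mod n then 1 else 0)"
    using Suc.prems by (simp add: index_shift_mat mod_Suc_eq)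
  finally show ?case .
qed

lemma kronecker_carrier:
  assumes "A \<in> carrier_mat nr nc" "B \<in> carrier_mat nr' nc'"
  shows "A \<otimes>\<^sub>K B \<in> carrier_mat (nr * nr') (nc * nc')"
  using assms by (auto simp: kronecker_def)

lemma index_one_kronecker:
  assumes "B \<in> carrier_mat m m" "i < d * m" "j < d * m"
  shows "(1\<^sub>m d \<otimes>\<^sub>K B) $$ (i, j) =
    (if i div m = j div m then B $$ (i mod m, j mod m) else (0 :: 'a :: semiring_1))"
  using assms by (auto simp: kronecker_def less_mult_imp_div_less)

lemma sigma_eq:
  assumes "0 < s" "s < n" "i < n"
  shows "sigma n s i = (s * (i mod gcd_quot n s) + i div gcd_quot n s) mod n"
  using rho_eq[OF assms] ell_eq[OF assms] by (simp add: sigma_def F_map_def J_map_def)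

text \<open>Since \<open>sigma n s\<close> is injective on the indices, it is enough to exhibit one
  index whose image is \<open>sigma n s i\<close> advanced by \<open>s\<close> modulo
  \<open>n\<close>; then \<open>j\<close> must equal it.\<close>

lemma sigma_step:
  fixes n s :: nat
  defines "m \<equiv> gcd_quot n s"
  assumes s: "0 < s" "s < n" and ij: "i < n" "j < n"
  shows "sigma n s j = (sigma n s i + s) mod n \<longleftrightarrow>
    i div m = j div m \<and> j mod m = Suc (i mod m) mod m"
proof -
  have n: "n = gcd n s * m" by (simp add: m_def gcd_quot_def)
  have m: "0 < m" using n s by (cases "m = 0") auto
  \<comment> \<open>The cyclic successor of \<open>i\<close> inside its own block of length
    \<open>m\<close>.\<close>
  define i' where "i' = i div m * m + Suc (i mod m) mod m"
  have div_i': "i' div m = i div m" and mod_i': "i' mod m = Suc (i mod m) mod m"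
    using m by (simp_all add: i'_def)
  have "i div m < gcd n s"
    using ij n by (metis less_mult_imp_div_less)
  then have "i' div m < gcd n s" by (simp add: div_i')
  then have i': "i' < n"
    using n m by (metis div_less_iff_less_mult)
  \<comment> \<open>With \<open>g = gcd n s\<close>, the product \<open>s * (n div g)\<close> equals
    \<open>(s div g) * n\<close>.\<close>
  have "n dvd s * m"
    unfolding m_def gcd_quot_def
    by (metis div_mult_swap dvd_div_mult dvd_triv_left gcd_dvd1 gcd_dvd2 mult.commute)
  \<comment> \<open>Reducing \<open>k\<close> modulo \<open>m\<close> changes \<open>s * k\<close>
    by a multiple of \<open>s * m\<close>, hence of \<open>n\<close>. This covers the last position
    of a block without a case split.\<close>
  then have wrap: "[s * (k mod m) = s * k] (mod n)" for k
    by (rule cong_dvd_modulus_nat[rotated]) (simp add: cong_def mult_mod_right[symmetric])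
  have "[sigma n s i' = s * (Suc (i mod m) mod m) + i div m] (mod n)"
    using sigma_eq[OF s i'] div_i' mod_i' by (simp add: m_def cong_def)
  also have "[s * (Suc (i mod m) mod m) + i div m = s * Suc (i mod m) + i div m] (mod n)"
    by (intro cong_add wrap cong_refl)
  also have "s * Suc (i mod m) + i div m = s * (i mod m) + i div m + s"
    by simp
  also have "[s * (i mod m) + i div m + s = sigma n s i + s] (mod n)"
    using sigma_eq[OF s ij(1)] by (simp add: m_def cong_def mod_add_left_eq)
  finally have step: "sigma n s i' = (sigma n s i + s) mod n"
    \<comment> \<open>The value \<open>sigma n s i'\<close> is already below \<open>n\<close>, so
      the congruence becomes an equality.\<close>
    using bij_betwE[OF bij_betw_sigma[OF s]] i' by (auto simp: cong_def)
  have "sigma n s j = sigma n s i' \<longleftrightarrow> j = i'"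
    using bij_betw_sigma[OF s] ij i' by (auto simp: bij_betw_def inj_on_eq_iff)
  also have "\<dots> \<longleftrightarrow> j div m = i' div m \<and> j mod m = i' mod m"
    by (metis div_mult_mod_eq)
  finally show ?thesis by (auto simp: step div_i' mod_i')
qed

text \<open>The case of the theorem with first exponent 0. Entrywise, injectivity of
  \<open>sigma n s\<close> matches the identity parts and \<open>sigma_step\<close> matches the
  shift parts.\<close>

lemma conjugate_kronecker_shift:
  fixes n s :: nat and a b :: complex
  defines "m \<equiv> gcd_quot n s"
  assumes s: "0 < s" "s < n"
  shows "perm_mat n (sigma n s) * (1\<^sub>m (gcd n s) \<otimes>\<^sub>K (a \<cdot>\<^sub>m 1\<^sub>m m + b \<cdot>\<^sub>m shift_mat m))
      * transpose_mat (perm_mat n (sigma n s)) = a \<cdot>\<^sub>m 1\<^sub>m n + b \<cdot>\<^sub>m (shift_mat n ^\<^sub>m s)"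
proof (rule conjugate_perm_mat_eqI[OF bij_betw_sigma[OF s]])
  let ?B = "a \<cdot>\<^sub>m 1\<^sub>m m + b \<cdot>\<^sub>m shift_mat m"
  have n: "n = gcd n s * m" by (simp add: m_def gcd_quot_def)
  have m: "0 < m" using n s by (cases "m = 0") auto
  have B: "?B \<in> carrier_mat m m" by simp
  show "1\<^sub>m (gcd n s) \<otimes>\<^sub>K ?B \<in> carrier_mat n n"
    using n kronecker_carrier[OF one_carrier_mat B, of "gcd n s"] by simp
  show "a \<cdot>\<^sub>m 1\<^sub>m n + b \<cdot>\<^sub>m (shift_mat n ^\<^sub>m s) \<in> carrier_mat n n"
    by simp
  fix i j assume ij: "i < n" "j < n"
  have lt: "sigma n s i < n" "sigma n s j < n"
    using bij_betwE[OF bij_betw_sigma[OF s]] ij by auto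
  have inj: "sigma n s i = sigma n s j \<longleftrightarrow> i = j"
    using bij_betw_sigma[OF s] ij by (auto simp: bij_betw_def inj_on_eq_iff)
  have eq: "i = j \<longleftrightarrow> i div m = j div m \<and> i mod m = j mod m"
    by (metis div_mult_mod_eq)
  have "(a \<cdot>\<^sub>m 1\<^sub>m n + b \<cdot>\<^sub>m (shift_mat n ^\<^sub>m s)) $$ (sigma n s i, sigma n s j) =
      a * (if i = j then 1 else 0) +
      b * (if sigma n s j = (sigma n s i + s) mod n then 1 else 0)"
    using lt by (simp add: inj index_shift_mat_pow del: pow_mat_dim)
  also have "\<dots> = (if i div m = j div m then ?B $$ (i mod m, j mod m) else 0)"
    using m shift_mat_carrier[of m] sigma_step[OF s ij]
    by (auto simp: eq index_shift_mat m_def)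
  also have "\<dots> = (1\<^sub>m (gcd n s) \<otimes>\<^sub>K ?B) $$ (i, j)"
    using index_one_kronecker[OF B, of i "gcd n s" j] ij n by simp
  finally show "(a \<cdot>\<^sub>m 1\<^sub>m n + b \<cdot>\<^sub>m (shift_mat n ^\<^sub>m s)) $$ (sigma n s i, sigma n s j) =
      (1\<^sub>m (gcd n s) \<otimes>\<^sub>K ?B) $$ (i, j)" .
qed

text \<open>Matrix powers grow by a factor on the right, hence the induction on the second
  exponent.\<close>

lemma pow_mat_add:
  fixes A :: "'a :: semiring_1 mat"
  assumes A: "A \<in> carrier_mat n n"
  shows "A ^\<^sub>m (k + l) = A ^\<^sub>m k * A ^\<^sub>m l"
proof (induction l)
  case 0
  show ?case using A by (simp add: right_mult_one_mat[OF pow_carrier_mat[OF A]])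
next
  case (Suc l)
  then show ?case
    using assoc_mult_mat[OF pow_carrier_mat[OF A] pow_carrier_mat[OF A] A] by simp
qed

theorem theorem3p4:
  fixes n s1 s2 s d m :: nat and a b :: complex
  assumes "0 \<le> s1" and "s1 < s2" and "s2 < n"
    and "a \<noteq> 0" and "b \<noteq> 0"
    and "s = s2 - s1" and "d = gcd n s" and "m = gcd_quot n s"
  shows "(a \<cdot>\<^sub>m (shift_mat n ^\<^sub>m s1)) + (b \<cdot>\<^sub>m (shift_mat n ^\<^sub>m s2)) =
    (shift_mat n ^\<^sub>m s1) * perm_mat n (sigma n s)
      * (1\<^sub>m d \<otimes>\<^sub>K ((a \<cdot>\<^sub>m 1\<^sub>m m) + (b \<cdot>\<^sub>m shift_mat m)))
      * transpose_mat (perm_mat n (sigma n s))"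
proof -
  have s: "0 < s" "s < n" "s2 = s1 + s" using assms by auto
  let ?P = "shift_mat n" and ?Q = "perm_mat n (sigma n s)"
  let ?K = "1\<^sub>m d \<otimes>\<^sub>K ((a \<cdot>\<^sub>m 1\<^sub>m m) + (b \<cdot>\<^sub>m shift_mat m))"
  have pow: "?P ^\<^sub>m k \<in> carrier_mat n n" for k by simp
  have Q: "?Q \<in> carrier_mat n n" "transpose_mat ?Q \<in> carrier_mat n n" by simp_all
  have "d * m = n" using assms by (simp add: gcd_quot_def)
  then have K: "?K \<in> carrier_mat n n"
    using kronecker_carrier[of "1\<^sub>m d" d d "a \<cdot>\<^sub>m 1\<^sub>m m + b \<cdot>\<^sub>m shift_mat m" m m] by simp
  \<comment> \<open>Reassociating isolates the conjugate of the block diagonal matrix as a single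
    right factor.\<close>
  have "?P ^\<^sub>m s1 * ?Q * ?K * transpose_mat ?Q = ?P ^\<^sub>m s1 * (?Q * ?K * transpose_mat ?Q)"
    using assoc_mult_mat[OF pow Q(1) K] assoc_mult_mat[OF pow mult_carrier_mat[OF Q(1) K] Q(2)]
    by simp
  also have "\<dots> = ?P ^\<^sub>m s1 * (a \<cdot>\<^sub>m 1\<^sub>m n + b \<cdot>\<^sub>m (?P ^\<^sub>m s))"
    using conjugate_kronecker_shift[OF s(1,2), of a b] assms by simp
  also have "\<dots> = a \<cdot>\<^sub>m (?P ^\<^sub>m s1) + b \<cdot>\<^sub>m (?P ^\<^sub>m s1 * ?P ^\<^sub>m s)"
    using pow by (simp add: mult_add_distrib_mat[of _ n n _ n] mult_smult_distrib[of _ n n _ n])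
  also have "?P ^\<^sub>m s1 * ?P ^\<^sub>m s = ?P ^\<^sub>m s2"
    by (simp add: s(3) pow_mat_add[OF shift_mat_carrier])
  finally show ?thesis by simp
qed

end
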